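(* Let $\alpha:[0,1]\to[0,\infty)$ be measurable with $\alpha(t)>0$ for almost every $t\in[0,1]$. Assume that $\alpha(\cdot)$ is bounded and satisfies the following regularity condition: there exist $c_1,c_2>0$ such that $$c_1\alpha(s)\le\alpha(t)\le c_2\alpha(s),\qquad s\le t\le\min\{2s,1\},\quad 0\le s\le 1 .$$ Then the operator $R^{\alpha(\cdot)}$ is bounded in $L_1[0,1]$ if and only if $$\int_0^1\alpha(t)\,t^{\alpha(t)-1}\,dt<\infty .$$
   Context: For a measurable function $\alpha:[0,1]\to[0,\infty)$ with $\alpha(t)>0$ for almost every $t$, the Riemann--Liouville operator of variable order is $$(R^{\alpha(\cdot)}f)(t):=\frac{1}{\Gamma(\alpha(t))}\int_0^t (t-s)^{\alpha(t)-1}f(s)\,ds,\qquad t\in[0,1],$$ for $f\in L_1[0,1]$ (the integral exists for almost every $t$). "Bounded in $L_1[0,1]$" means that it is a bounded linear operator from $L_1[0,1]$ to $L_1[0,1]$. *)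

theory Defs
  imports "HOL-Analysis.Analysis"
begin

text \<open>
  Elements of \<open>L\<^sub>1[0,1]\<close> are represented by functions on \<^typ>\<open>real\<close>, of which only the values
  on \<open>[0,1]\<close> are relevant, modulo equality almost everywhere on \<open>[0,1]\<close>.
\<close>

definition L1 :: "(real \<Rightarrow> real) set" where
  "L1 = {f. integrable (lebesgue_on {0..1}) f}"

definition L1_norm :: "(real \<Rightarrow> real) \<Rightarrow> real" where
  "L1_norm f = (LINT t|lebesgue_on {0..1}. \<bar>f t\<bar>)"

definition L1_eq :: "(real \<Rightarrow> real) \<Rightarrow> (real \<Rightarrow> real) \<Rightarrow> bool" where
  "L1_eq f g \<longleftrightarrow> (AE t in lebesgue_on {0..1}. f t = g t)"

text \<open>
  The map \<open>T\<close> on representatives induces a bounded linear operator on the space of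
  equivalence classes: it is defined on all of \<open>L\<^sub>1[0,1]\<close> with values in \<open>L\<^sub>1[0,1]\<close>,
  well defined on classes, linear, and bounded for the norm.
\<close>

definition bounded_operator_L1 :: "((real \<Rightarrow> real) \<Rightarrow> real \<Rightarrow> real) \<Rightarrow> bool" where
  "bounded_operator_L1 T \<longleftrightarrow>
     (\<forall>f\<in>L1. T f \<in> L1) \<and>
     (\<forall>f\<in>L1. \<forall>g\<in>L1. L1_eq f g \<longrightarrow> L1_eq (T f) (T g)) \<and>
     (\<forall>f\<in>L1. \<forall>g\<in>L1. L1_eq (T (\<lambda>t. f t + g t)) (\<lambda>t. T f t + T g t)) \<and>
     (\<forall>c. \<forall>f\<in>L1. L1_eq (T (\<lambda>t. c * f t)) (\<lambda>t. c * T f t)) \<and>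
     (\<exists>C. \<forall>f\<in>L1. L1_norm (T f) \<le> C * L1_norm f)"

text \<open>
  For \<open>f\<close> in \<open>L\<^sub>1[0,1]\<close> the integral exists for almost every \<open>t\<close>; on the exceptional null set
  the Bochner integral is \<open>0\<close> by convention.
\<close>

definition riemann_liouville :: "(real \<Rightarrow> real) \<Rightarrow> (real \<Rightarrow> real) \<Rightarrow> real \<Rightarrow> real" where
  "riemann_liouville \<alpha> f t =
     1 / Gamma (\<alpha> t) * (LINT s:{0..t}|lebesgue. (t - s) powr (\<alpha> t - 1) * f s)"

end

theory Submission
  imports Defs
begin

text \<open>
  The operator has the nonnegative kernel
  \<open>k(t,s) = (t - s) powr (\<alpha> t - 1) / \<Gamma>(\<alpha> t)\<close> on \<open>0 \<le> s \<le> t\<close>. By Tonelli's theorem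
  it is bounded on \<open>L\<^sub>1[0,1]\<close> as soon as the column integrals \<open>\<integral> k(t,s) dt\<close> are bounded uniformly
  in \<open>s\<close> (\<open>bounded_operator_L1_kernel\<close>). Write \<open>A\<close> for an upper bound of \<open>\<alpha>\<close>. Since \<open>1 / \<Gamma>(a)\<close> is
  comparable to \<open>a\<close> on \<open>[0,A]\<close> (\<open>rGamma_linear_bounds\<close>), the assertion is that the column integrals
  are controlled by the one at \<open>s = 0\<close>. The second basic observation is that
  \<open>(t - s) powr (a - 1)\<close> and \<open>t powr (a - 1)\<close> are comparable for \<open>s \<le> t / 2\<close>, uniformly in
  \<open>a \<in> [0,A]\<close> (\<open>powr_half_bounds\<close>).

  If the integral of \<open>\<alpha> t * t powr (\<alpha> t - 1)\<close> is finite, split the column integral at \<open>t = 2 * s\<close>.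
  The part over \<open>t > 2 * s\<close> is at most a multiple of that integral by comparability. For
  \<open>s \<le> t \<le> 2 * s\<close> the regularity condition replaces \<open>\<alpha> t\<close> by multiples of \<open>a = \<alpha> s\<close>: as
  \<open>t - s \<le> 1\<close>, this part is at most a multiple of
  \<open>c2 * a * \<integral>\<^sub>0\<^sup>1 u powr (c1 * a - 1) du = c2 / c1\<close>, which does not depend on \<open>s\<close>
  (it vanishes if \<open>a = 0\<close>).

  Conversely, a bounded operator is tested on the normalised indicators of \<open>[0,h]\<close>. By comparability
  their images dominate a fixed multiple of \<open>\<alpha> t * t powr (\<alpha> t - 1)\<close> for \<open>t \<ge> 2 * h\<close>, and
  monotone convergence as \<open>h\<close> tends to \<open>0\<close> gives the finiteness of the integral.
\<close>

section \<open>Elementary estimates\<close>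

lemma measurable_ident_lebesgue_on: "(\<lambda>x. x) \<in> lebesgue_on S \<rightarrow>\<^sub>M (borel :: real measure)"
  by (intro measurable_restrict_space1 measurable_completion) simp

text \<open>
  The point \<open>a = 0\<close> is included because \<^const>\<open>rGamma\<close> vanishes there; it is also \<open>1 / Gamma 0\<close>
  with the convention \<open>Gamma 0 = 0\<close>.
\<close>

lemma rGamma_linear_bounds:
  fixes A :: real
  assumes "A \<ge> 0"
  obtains m G where "m > 0" "G > 0"
    "\<And>a. 0 \<le> a \<Longrightarrow> a \<le> A \<Longrightarrow> m * a \<le> rGamma a \<and> rGamma a \<le> G * a"
proof -
  \<comment> \<open>\<open>rGamma a = a * rGamma (a + 1)\<close>, and \<open>rGamma\<close> is continuous and positive on \<open>{1..A+1}\<close>.\<close>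
  have cont: "continuous_on {1..A+1} (rGamma :: real \<Rightarrow> real)"
    by (intro continuous_intros)
  have ne: "{1..A+1} \<noteq> {}" using assms by simp
  obtain x where x: "x \<in> {1..A+1}" "\<And>y. y \<in> {1..A+1} \<Longrightarrow> rGamma x \<le> rGamma y"
    using continuous_attains_inf[OF compact_Icc ne cont] by blast
  obtain z where z: "z \<in> {1..A+1}" "\<And>y. y \<in> {1..A+1} \<Longrightarrow> rGamma y \<le> rGamma z"
    using continuous_attains_sup[OF compact_Icc ne cont] by blast
  have pos: "rGamma y > 0" if "y \<in> {1..A+1}" for y :: real
    using that Gamma_real_pos[of y] by (simp add: rGamma_inverse_Gamma)
  show ?thesis
  proof
    show "rGamma x > 0" "rGamma z > 0" using pos x z by auto
    fix a :: real assume a: "0 \<le> a" "a \<le> A"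
    have eq: "rGamma a = a * rGamma (a + 1)" by (simp add: rGamma_plus1)
    have "a + 1 \<in> {1..A+1}" using a by auto
    from x(2)[OF this] z(2)[OF this] a(1)
    show "rGamma x * a \<le> rGamma a \<and> rGamma a \<le> rGamma z * a"
      unfolding eq by (auto simp: mult.commute[of _ a] intro: mult_left_mono)
  qed
qed

lemma powr_half_bounds:
  fixes a A t u :: real
  assumes "0 \<le> a" "a \<le> A" "0 < t" "t / 2 \<le> u" "u \<le> t"
  shows "(1/2) powr A * t powr (a - 1) \<le> u powr (a - 1)"
    and "u powr (a - 1) \<le> 2 * t powr (a - 1)"
proof -
  define r where "r = u / t"
  have r: "1/2 \<le> r" "r \<le> 1" using assms by (auto simp: r_def field_simps)
  have u: "u powr (a - 1) = r powr (a - 1) * t powr (a - 1)"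
    using assms by (simp add: r_def powr_divide)
  have "(1/2) powr A \<le> (1/2 :: real) powr (max 0 (a - 1))"
    using assms by (intro powr_mono') auto
  also have "\<dots> \<le> r powr (max 0 (a - 1))"
    using r by (intro powr_mono2) auto
  also have "\<dots> \<le> r powr (a - 1)"
    using r by (intro powr_mono') auto
  finally show "(1/2) powr A * t powr (a - 1) \<le> u powr (a - 1)"
    unfolding u by (intro mult_right_mono) auto
  have "r powr (a - 1) \<le> r powr (- 1)"
    using r assms by (intro powr_mono') auto
  also have "\<dots> \<le> 2" using r by (simp add: powr_minus field_simps)
  finally show "u powr (a - 1) \<le> 2 * t powr (a - 1)"
    unfolding u by (intro mult_right_mono) auto
qed

lemma nn_integral_powr_unit:
  fixes p s :: real
  assumes "p > 0"
  shows "(\<integral>\<^sup>+t. ennreal (indicator {s..s+1} t * (t - s) powr (p - 1)) \<partial>lebesgue) = ennreal (1 / p)"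
proof -
  have "((\<lambda>x. x powr (p - 1)) has_integral (1 powr (p - 1 + 1) / (p - 1 + 1))) {0..1}"
    using assms by (intro has_integral_powr_from_0) auto
  then have hi: "((\<lambda>x::real. indicator {0..1} x * x powr (p - 1)) has_integral (1 / p)) UNIV"
    using has_integral_restrict_UNIV[of "{0..1}" "\<lambda>x::real. x powr (p - 1)" "1 / p"]
    by (simp add: indicator_def of_bool_def if_distrib if_distribR cong: if_cong)
  have "(\<integral>\<^sup>+x. ennreal (indicator {0..1} x * x powr (p - 1)) \<partial>lborel) = ennreal (1 / p)"
    by (rule nn_integral_has_integral_lborel[OF _ _ hi]) auto
  moreover have "(\<integral>\<^sup>+t. ennreal (indicator {s..s+1} t * (t - s) powr (p - 1)) \<partial>lborel)
     = ennreal \<bar>1\<bar> * (\<integral>\<^sup>+x. ennreal (indicator {s..s+1} (s + 1 * x) * ((s + 1 * x) - s) powr (p - 1)) \<partial>lborel)"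
    by (rule nn_integral_real_affine) auto
  moreover have "(indicator {s..s+1} (s + 1 * x) :: real) = indicator {0..1} x" for x
    by (auto simp: indicator_def)
  ultimately show ?thesis
    by (simp add: nn_integral_completion)
qed

section \<open>Integral operators with bounded column integrals\<close>

text \<open>
  If \<open>\<integral> \<bar>k(t,s)\<bar> dt \<le> B\<close> for every \<open>s\<close>, the operator with kernel \<open>k\<close> is bounded on
  \<open>L\<^sub>1[0,1]\<close>. No separate hypothesis \<open>B \<ge> 0\<close> is needed, since \<^const>\<open>ennreal\<close> truncates at \<open>0\<close>.
\<close>

lemma bounded_operator_L1_kernel:
  fixes k :: "real \<times> real \<Rightarrow> real" and B :: real
  defines "M \<equiv> lebesgue_on {0..1::real}"
  assumes k[measurable]: "k \<in> borel_measurable (M \<Otimes>\<^sub>M M)"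
    and col: "\<And>s. s \<in> {0..1} \<Longrightarrow> (\<integral>\<^sup>+t. ennreal \<bar>k (t, s)\<bar> \<partial>M) \<le> ennreal B"
    and T: "\<And>f t. t \<in> {0..1} \<Longrightarrow> T f t = (LINT s|M. k (t, s) * f s)"
  shows "bounded_operator_L1 T"
proof -
  have spM: "space M = {0..1}" by (simp add: M_def)
  interpret M: finite_measure M
    unfolding M_def by (rule finite_measure_lebesgue_on) auto
  interpret P: pair_sigma_finite M M ..
  have total: "(\<integral>\<^sup>+t. \<integral>\<^sup>+s. ennreal \<bar>k (t, s) * f s\<bar> \<partial>M \<partial>M) \<le> ennreal B * (\<integral>\<^sup>+s. ennreal \<bar>f s\<bar> \<partial>M)"
    if [measurable]: "f \<in> borel_measurable M" for f
  proof -
    have "(\<integral>\<^sup>+t. \<integral>\<^sup>+s. ennreal \<bar>k (t, s) * f s\<bar> \<partial>M \<partial>M)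
        = (\<integral>\<^sup>+s. \<integral>\<^sup>+t. ennreal \<bar>k (t, s) * f s\<bar> \<partial>M \<partial>M)"
      by (rule P.Fubini'[symmetric]) measurable
    also have "\<dots> = (\<integral>\<^sup>+s. (\<integral>\<^sup>+t. ennreal \<bar>k (t, s)\<bar> \<partial>M) * ennreal \<bar>f s\<bar> \<partial>M)"
      by (intro nn_integral_cong, subst nn_integral_multc[symmetric])
         (auto simp: abs_mult ennreal_mult)
    also have "\<dots> \<le> (\<integral>\<^sup>+s. ennreal B * ennreal \<bar>f s\<bar> \<partial>M)"
      using col spM by (intro nn_integral_mono mult_right_mono) auto
    also have "\<dots> = ennreal B * (\<integral>\<^sup>+s. ennreal \<bar>f s\<bar> \<partial>M)"
      by (rule nn_integral_cmult) auto
    finally show ?thesis .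
  qed
  have int: "integrable (M \<Otimes>\<^sub>M M) (\<lambda>(t, s). k (t, s) * f s)" if f: "integrable M f" for f
  proof -
    note [measurable] = borel_measurable_integrable[OF f]
    have "(\<integral>\<^sup>+s. ennreal \<bar>f s\<bar> \<partial>M) < \<infinity>"
      using f by (simp add: integrable_iff_bounded)
    then have "(\<integral>\<^sup>+t. \<integral>\<^sup>+s. ennreal \<bar>k (t, s) * f s\<bar> \<partial>M \<partial>M) < \<infinity>"
      using total[of f] by (auto simp: ennreal_mult_less_top intro: order.strict_trans1)
    moreover have "(\<integral>\<^sup>+x. ennreal (norm (case x of (t, s) \<Rightarrow> k (t, s) * f s)) \<partial>(M \<Otimes>\<^sub>M M))
       = (\<integral>\<^sup>+t. \<integral>\<^sup>+s. ennreal \<bar>k (t, s) * f s\<bar> \<partial>M \<partial>M)"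
      using M.nn_integral_fst[of "\<lambda>(t, s). ennreal \<bar>k (t, s) * f s\<bar>" M]
      by (simp add: case_prod_beta')
    ultimately show ?thesis
      unfolding integrable_iff_bounded by simp
  qed
  have AEint: "AE t in M. integrable M (\<lambda>s. k (t, s) * f s)" if "integrable M f" for f
    using P.AE_integrable_fst[OF int[OF that]] by simp
  have L1M: "L1 = {f. integrable M f}" "L1_norm = (\<lambda>f. LINT t|M. \<bar>f t\<bar>)"
    "L1_eq = (\<lambda>f g. AE t in M. f t = g t)"
    unfolding L1_def L1_norm_def L1_eq_def M_def by (rule refl ext)+
  have Tint: "integrable M (T f)" if f: "integrable M f" for f
  proof -
    have "integrable M (\<lambda>t. LINT s|M. k (t, s) * f s)"
      using P.integrable_fst[OF int[OF f]] by simp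
    then show ?thesis
      by (subst Bochner_Integration.integrable_cong[OF refl T]) (auto simp: spM)
  qed
  have bound: "(LINT t|M. \<bar>T f t\<bar>) \<le> max 0 B * (LINT t|M. \<bar>f t\<bar>)" if f: "integrable M f" for f
  proof -
    note [measurable] = borel_measurable_integrable[OF f]
    have "ennreal (LINT t|M. \<bar>T f t\<bar>) = (\<integral>\<^sup>+t. ennreal \<bar>T f t\<bar> \<partial>M)"
      using Tint[OF f] by (intro nn_integral_eq_integral[symmetric]) auto
    also have "\<dots> \<le> (\<integral>\<^sup>+t. \<integral>\<^sup>+s. ennreal \<bar>k (t, s) * f s\<bar> \<partial>M \<partial>M)"
    proof (rule nn_integral_mono_AE)
      show "AE t in M. ennreal \<bar>T f t\<bar> \<le> (\<integral>\<^sup>+s. ennreal \<bar>k (t, s) * f s\<bar> \<partial>M)"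
        using AEint[OF f] AE_space[of M]
      proof eventually_elim
        case (elim t)
        then show ?case
          using integral_norm_bound_ennreal[OF elim(1)] T[of t f] by (simp add: spM)
      qed
    qed
    also have "\<dots> \<le> ennreal B * (\<integral>\<^sup>+t. ennreal \<bar>f t\<bar> \<partial>M)"
      by (rule total) measurable
    also have "(\<integral>\<^sup>+t. ennreal \<bar>f t\<bar> \<partial>M) = ennreal (LINT t|M. \<bar>f t\<bar>)"
      using f by (intro nn_integral_eq_integral) auto
    also have "ennreal B * ennreal (LINT t|M. \<bar>f t\<bar>) = ennreal (max 0 B * (LINT t|M. \<bar>f t\<bar>))"
      by (subst ennreal_mult) (auto simp: max_def ennreal_neg)
    finally show ?thesis
      by (subst (asm) ennreal_le_iff) auto
  qed
  show ?thesis
    unfolding bounded_operator_L1_def L1M mem_Collect_eq Ball_def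
  proof (intro conjI allI impI)
    fix f :: "real \<Rightarrow> real" assume "integrable M f" then show "integrable M (T f)" by (rule Tint)
  next
    fix f g :: "real \<Rightarrow> real" assume f: "integrable M f" and g: "integrable M g" and eq: "AE t in M. f t = g t"
    note [measurable] = borel_measurable_integrable[OF f] borel_measurable_integrable[OF g]
    show "AE t in M. T f t = T g t"
    proof (rule AE_I2)
      fix t assume t[measurable]: "t \<in> space M"
      have "(LINT s|M. k (t, s) * f s) = (LINT s|M. k (t, s) * g s)"
        using eq by (intro integral_cong_AE) auto
      then show "T f t = T g t" using t T by (simp add: spM)
    qed
  next
    fix f g :: "real \<Rightarrow> real" assume f: "integrable M f" and g: "integrable M g"
    show "AE t in M. T (\<lambda>t. f t + g t) t = T f t + T g t"
      using AEint[OF f] AEint[OF g] AE_space[of M]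
      by eventually_elim (simp add: T spM distrib_left)
  next
    fix c and f :: "real \<Rightarrow> real" assume f: "integrable M f"
    show "AE t in M. T (\<lambda>t. c * f t) t = c * T f t"
      by (rule AE_I2) (simp add: T spM mult.left_commute)
  next
    show "\<exists>C. \<forall>f. integrable M f \<longrightarrow> (LINT t|M. \<bar>T f t\<bar>) \<le> C * (LINT t|M. \<bar>f t\<bar>)"
      using bound by blast
  qed
qed

section \<open>The Riemann--Liouville kernel\<close>

text \<open>
  The kernel of the Riemann--Liouville operator at the pair \<open>(t, s)\<close>, output variable first. It is
  extended by \<open>0\<close> outside \<open>0 \<le> s \<le> t\<close>, so that the integral over \<open>{0..t}\<close> becomes one over the
  fixed interval \<open>{0..1}\<close>.
\<close>

definition rl_kernel :: "(real \<Rightarrow> real) \<Rightarrow> real \<times> real \<Rightarrow> real" where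
  "rl_kernel \<alpha> = (\<lambda>(t, s). indicator {0..t} s * (rGamma (\<alpha> t) * (t - s) powr (\<alpha> t - 1)))"

lemma riemann_liouville_kernel:
  assumes "t \<in> {0..1}"
  shows "riemann_liouville \<alpha> f t = (LINT s|lebesgue_on {0..1}. rl_kernel \<alpha> (t, s) * f s)"
proof -
  have "(LINT s|lebesgue_on {0..1}. rl_kernel \<alpha> (t, s) * f s)
      = (LINT s|lebesgue. rGamma (\<alpha> t) * (indicator {0..t} s *\<^sub>R ((t - s) powr (\<alpha> t - 1) * f s)))"
    using assms
    by (subst integral_restrict_space)
       (auto simp: rl_kernel_def indicator_def simp del: integral_mult_right_zero
         intro!: Bochner_Integration.integral_cong)
  also have "\<dots> = riemann_liouville \<alpha> f t"
    by (simp add: riemann_liouville_def set_lebesgue_integral_def rGamma_inverse_Gamma field_simps)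
  finally show ?thesis by simp
qed

lemma measurable_rl_kernel:
  assumes [measurable]: "\<alpha> \<in> borel_measurable (lebesgue_on {0..1})"
  shows "rl_kernel \<alpha> \<in> borel_measurable (lebesgue_on {0..1} \<Otimes>\<^sub>M lebesgue_on {0..1})"
proof -
  have [measurable]: "(\<lambda>x. x) \<in> lebesgue_on {0..1::real} \<rightarrow>\<^sub>M borel"
    by (rule measurable_ident_lebesgue_on)
  have [measurable]: "rGamma \<in> borel_measurable (borel :: real measure)"
    by (intro borel_measurable_continuous_onI continuous_intros)
  have eq: "rl_kernel \<alpha> = (\<lambda>x. (if 0 \<le> snd x \<and> snd x \<le> fst x then 1 else 0) *
      (rGamma (\<alpha> (fst x)) * (fst x - snd x) powr (\<alpha> (fst x) - 1)))"
    by (auto simp: rl_kernel_def fun_eq_iff indicator_def)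
  have [measurable]: "fst \<in> (lebesgue_on {0..1::real} \<Otimes>\<^sub>M lebesgue_on {0..1::real}) \<rightarrow>\<^sub>M borel"
     "snd \<in> (lebesgue_on {0..1::real} \<Otimes>\<^sub>M lebesgue_on {0..1::real}) \<rightarrow>\<^sub>M borel"
    by (rule measurable_compose[OF measurable_fst measurable_ident_lebesgue_on]
             measurable_compose[OF measurable_snd measurable_ident_lebesgue_on])+
  show ?thesis unfolding eq by measurable
qed

section \<open>Boundedness and the integral condition\<close>

lemma riemann_liouville_bounded:
  fixes \<alpha> :: "real \<Rightarrow> real"
  defines "M \<equiv> lebesgue_on {0..1}"
  assumes meas: "\<alpha> \<in> borel_measurable M"
    and nonneg: "\<And>t. t \<in> {0..1} \<Longrightarrow> 0 \<le> \<alpha> t"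
    and le: "\<And>t. t \<in> {0..1} \<Longrightarrow> \<alpha> t \<le> A"
    and c: "c1 > 0" "c2 > 0"
    and reg: "\<And>s t. s \<in> {0..1} \<Longrightarrow> s \<le> t \<Longrightarrow> t \<le> min (2 * s) 1 \<Longrightarrow>
       c1 * \<alpha> s \<le> \<alpha> t \<and> \<alpha> t \<le> c2 * \<alpha> s"
    and fin: "(\<integral>\<^sup>+t. ennreal (\<alpha> t * t powr (\<alpha> t - 1)) \<partial>M) < \<infinity>"
  shows "bounded_operator_L1 (riemann_liouville \<alpha>)"
proof -
  have spM: "space M = {0..1}" by (simp add: M_def)
  note [measurable] = meas
  have [measurable]: "(\<lambda>x. x) \<in> M \<rightarrow>\<^sub>M borel"
    unfolding M_def by (rule measurable_ident_lebesgue_on)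
  obtain J where J: "J \<ge> 0" "(\<integral>\<^sup>+t. ennreal (\<alpha> t * t powr (\<alpha> t - 1)) \<partial>M) = ennreal J"
    using fin by (cases "\<integral>\<^sup>+t. ennreal (\<alpha> t * t powr (\<alpha> t - 1)) \<partial>M") auto
  have "0 \<le> A" using nonneg[of 0] le[of 0] by simp
  then obtain m G where G: "G > 0" "\<And>a. 0 \<le> a \<Longrightarrow> a \<le> A \<Longrightarrow> m * a \<le> rGamma a \<and> rGamma a \<le> G * a"
    and m: "m > 0"
    using rGamma_linear_bounds by metis
  have col: "(\<integral>\<^sup>+t. ennreal \<bar>rl_kernel \<alpha> (t, s)\<bar> \<partial>M) \<le> ennreal (G * (2 * J + c2 / c1))"
    if s: "s \<in> {0..1}" for s
  proof -
    define p where "p = c1 * \<alpha> s"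
    have p0: "0 \<le> p" using c nonneg[OF s] by (simp add: p_def)
    \<comment> \<open>The diagonal part \<open>s \<le> t \<le> 2 * s\<close>; it is trivial when \<open>\<alpha> s = 0\<close>.\<close>
    have near: "(\<integral>\<^sup>+t. ennreal (c2 * \<alpha> s) * ennreal (indicator {s..s+1} t * (t - s) powr (p - 1)) \<partial>M)
        \<le> ennreal (c2 / c1)"
    proof (cases "\<alpha> s = 0")
      case False
      with nonneg[OF s] have a: "\<alpha> s > 0" by simp
      then have p: "p > 0" using c by (simp add: p_def)
      have "(\<integral>\<^sup>+t. ennreal (indicator {s..s+1} t * (t - s) powr (p - 1)) \<partial>M)
          \<le> (\<integral>\<^sup>+t. ennreal (indicator {s..s+1} t * (t - s) powr (p - 1)) \<partial>lebesgue)"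
        unfolding M_def
        by (subst nn_integral_restrict_space) (auto intro!: nn_integral_mono simp: indicator_def)
      also have "\<dots> = ennreal (1 / p)" by (rule nn_integral_powr_unit[OF p])
      finally have "ennreal (c2 * \<alpha> s) * (\<integral>\<^sup>+t. ennreal (indicator {s..s+1} t * (t - s) powr (p - 1)) \<partial>M)
          \<le> ennreal (c2 * \<alpha> s) * ennreal (1 / p)"
        by (rule mult_left_mono) simp
      also have "\<dots> = ennreal (c2 / c1)"
        using a c p by (simp add: ennreal_mult[symmetric] p_def)
      finally show ?thesis
        by (subst nn_integral_cmult) simp_all
    qed simp
    have pt: "ennreal \<bar>rl_kernel \<alpha> (t, s)\<bar> \<le> ennreal G * (2 * ennreal (\<alpha> t * t powr (\<alpha> t - 1))
         + ennreal (c2 * \<alpha> s) * ennreal (indicator {s..s+1} t * (t - s) powr (p - 1)))"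
      if t: "t \<in> {0..1}" for t
    proof -
      define X where "X = \<alpha> t * t powr (\<alpha> t - 1)"
      define Y where "Y = c2 * \<alpha> s * (indicator {s..s+1} t * (t - s) powr (p - 1))"
      have XY: "0 \<le> X" "0 \<le> Y" using nonneg[OF t] nonneg[OF s] c by (auto simp: X_def Y_def)
      have a: "0 \<le> \<alpha> t" "\<alpha> t \<le> A" using nonneg le t by auto
      have rG: "0 \<le> rGamma (\<alpha> t)" "rGamma (\<alpha> t) \<le> G * \<alpha> t"
        using G(2)[OF a] m a by (auto intro: order_trans[rotated])
      have main: "\<alpha> t * (t - s) powr (\<alpha> t - 1) \<le> 2 * X + Y" if "s \<le> t"
      proof (cases "t \<le> 2 * s")
        case True
        have r: "p \<le> \<alpha> t" "\<alpha> t \<le> c2 * \<alpha> s"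
          using reg[OF s that] True t by (auto simp: p_def)
        \<comment> \<open>Lowering the exponent increases the power because \<open>0 \<le> t - s \<le> 1\<close>.\<close>
        have "(t - s) powr (\<alpha> t - 1) \<le> (t - s) powr (p - 1)"
          using that t s r by (intro powr_mono') auto
        then have "\<alpha> t * (t - s) powr (\<alpha> t - 1) \<le> c2 * \<alpha> s * (t - s) powr (p - 1)"
          using r a by (intro mult_mono) auto
        also have "\<dots> = Y" using that t s by (simp add: Y_def)
        finally show ?thesis using XY by simp
      next
        case False
        have "(t - s) powr (\<alpha> t - 1) \<le> 2 * t powr (\<alpha> t - 1)"
          using a s t False by (intro powr_half_bounds(2)) auto
        then have "\<alpha> t * (t - s) powr (\<alpha> t - 1) \<le> 2 * X"
          using a mult_left_mono by (fastforce simp: X_def)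
        then show ?thesis using XY by simp
      qed
      have "\<bar>rl_kernel \<alpha> (t, s)\<bar> \<le> G * (2 * X + Y)"
      proof (cases "s \<le> t")
        case True
        have "\<bar>rl_kernel \<alpha> (t, s)\<bar> = rGamma (\<alpha> t) * (t - s) powr (\<alpha> t - 1)"
          using True s rG by (simp add: rl_kernel_def abs_mult)
        also have "\<dots> \<le> G * \<alpha> t * (t - s) powr (\<alpha> t - 1)"
          using rG by (intro mult_right_mono) auto
        also have "\<dots> \<le> G * (2 * X + Y)"
          using main[OF True] G(1) by (simp add: mult.assoc)
        finally show ?thesis .
      qed (use XY G in \<open>simp add: rl_kernel_def\<close>)
      then have "ennreal \<bar>rl_kernel \<alpha> (t, s)\<bar> \<le> ennreal (G * (2 * X + Y))"
        by (rule ennreal_leI)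
      also have "\<dots> = ennreal G * (2 * ennreal X + ennreal Y)"
        using G(1) XY by (simp add: ennreal_mult ennreal_plus)
      also have "ennreal Y = ennreal (c2 * \<alpha> s) * ennreal (indicator {s..s+1} t * (t - s) powr (p - 1))"
        using c nonneg[OF s] by (simp add: Y_def ennreal_mult[symmetric])
      finally show ?thesis unfolding X_def .
    qed
    have "(\<integral>\<^sup>+t. ennreal \<bar>rl_kernel \<alpha> (t, s)\<bar> \<partial>M) \<le>
      (\<integral>\<^sup>+t. ennreal G * (2 * ennreal (\<alpha> t * t powr (\<alpha> t - 1))
         + ennreal (c2 * \<alpha> s) * ennreal (indicator {s..s+1} t * (t - s) powr (p - 1))) \<partial>M)"
      using pt spM by (intro nn_integral_mono) auto
    also have "\<dots> = ennreal G * (2 * (\<integral>\<^sup>+t. ennreal (\<alpha> t * t powr (\<alpha> t - 1)) \<partial>M) +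
       (\<integral>\<^sup>+t. ennreal (c2 * \<alpha> s) * ennreal (indicator {s..s+1} t * (t - s) powr (p - 1)) \<partial>M))"
      by (subst nn_integral_cmult, measurable, subst nn_integral_add, measurable,
          subst (1) nn_integral_cmult, measurable)
    also have "\<dots> \<le> ennreal G * (2 * ennreal J + ennreal (c2 / c1))"
      unfolding J(2) by (intro mult_left_mono add_left_mono near) auto
    also have "\<dots> = ennreal (G * (2 * J + c2 / c1))"
      using G(1) J(1) c by (simp add: ennreal_mult ennreal_plus)
    finally show ?thesis .
  qed
  show ?thesis
    by (rule bounded_operator_L1_kernel[OF _ col[unfolded M_def] riemann_liouville_kernel])
       (use measurable_rl_kernel meas in \<open>simp_all add: M_def\<close>)
qed

lemma bounded_riemann_liouville_imp_finite:
  fixes \<alpha> :: "real \<Rightarrow> real"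
  defines "M \<equiv> lebesgue_on {0..1}"
  assumes meas: "\<alpha> \<in> borel_measurable M"
    and nonneg: "\<And>t. t \<in> {0..1} \<Longrightarrow> 0 \<le> \<alpha> t"
    and le: "\<And>t. t \<in> {0..1} \<Longrightarrow> \<alpha> t \<le> A"
    and bdd: "bounded_operator_L1 (riemann_liouville \<alpha>)"
  shows "(\<integral>\<^sup>+t. ennreal (\<alpha> t * t powr (\<alpha> t - 1)) \<partial>M) < \<infinity>"
proof -
  have spM: "space M = {0..1}" by (simp add: M_def)
  note [measurable] = meas
  have [measurable]: "(\<lambda>x. x) \<in> M \<rightarrow>\<^sub>M borel"
    unfolding M_def by (rule measurable_ident_lebesgue_on)
  interpret M: finite_measure M
    unfolding M_def by (rule finite_measure_lebesgue_on) auto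
  have "0 \<le> A" using nonneg[of 0] le[of 0] by simp
  then obtain m G where m: "m > 0"
     "\<And>a. 0 \<le> a \<Longrightarrow> a \<le> A \<Longrightarrow> m * a \<le> rGamma a \<and> rGamma a \<le> G * a"
    using rGamma_linear_bounds by metis
  \<comment> \<open>\<open>m\<close> comes from \<open>1 / \<Gamma>\<close>, the power of \<open>1/2\<close> from \<open>(t - s) powr (\<alpha> t - 1)\<close> for \<open>s \<le> t / 2\<close>.\<close>
  define d where "d = m * (1/2) powr A"
  have d: "d > 0" using m by (simp add: d_def)
  obtain C where C: "\<And>f. f \<in> L1 \<Longrightarrow> L1_norm (riemann_liouville \<alpha> f) \<le> C * L1_norm f"
    and L1: "\<And>f. f \<in> L1 \<Longrightarrow> riemann_liouville \<alpha> f \<in> L1"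
    using bdd unfolding bounded_operator_L1_def by blast
  define g where "g t = ennreal (\<alpha> t * t powr (\<alpha> t - 1))" for t
  have [measurable]: "g \<in> borel_measurable M" unfolding g_def by measurable
  define I where "I n = {2 / real (Suc n)..}" for n
  have part: "(\<integral>\<^sup>+t. g t * indicator (I n) t \<partial>M) \<le> ennreal (C / d)" for n
  proof -
    define h where "h = 1 / real (Suc n)"
    have h: "0 < h" "h \<le> 1" by (auto simp: h_def field_simps)
    have hM: "measure M {0..h} = h" "{0..h} \<in> sets M"
      using h by (auto simp: M_def measure_restrict_space sets_restrict_space_iff)
    define f where "f s = indicator {0..h} s / h" for s
    have fint: "integrable M f" unfolding f_def using hM(2) by (auto simp: M.emeasure_eq_measure)
    have "L1_norm f = (LINT t|M. indicator {0..h} t / h)"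
      unfolding L1_norm_def M_def f_def using h by simp
    also have "\<dots> = 1" using hM h spM by (simp add: Int_absorb2)
    finally have fn: "L1_norm f = 1" .
    have fL: "f \<in> L1" using fint by (simp add: L1_def M_def)
    have low: "d * (\<alpha> t * t powr (\<alpha> t - 1)) \<le> riemann_liouville \<alpha> f t"
      if t: "t \<in> {0..1}" "2 * h \<le> t" for t
    proof -
      have a: "0 \<le> \<alpha> t" "\<alpha> t \<le> A" using nonneg le t by auto
      define X where "X = t powr (\<alpha> t - 1)"
      have k: "rl_kernel \<alpha> (t, s) * f s = (rGamma (\<alpha> t) / h) * (indicator {0..h} s * (t - s) powr (\<alpha> t - 1))" for s
        using t h by (auto simp: rl_kernel_def f_def indicator_def)
      have b: "(1/2) powr A * X \<le> (t - s) powr (\<alpha> t - 1)" "(t - s) powr (\<alpha> t - 1) \<le> 2 * X"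
        if "s \<in> {0..h}" for s
        using powr_half_bounds[of "\<alpha> t" A t "t - s"] that a t h by (auto simp: X_def)
      have hi: "integrable M (indicator {0..h} :: real \<Rightarrow> real)"
        using hM(2) by (auto simp: M.emeasure_eq_measure)
      \<comment> \<open>For \<open>t \<ge> 2 * h\<close> the integrand is bounded, so its Bochner integral is a genuine one.\<close>
      have int: "integrable M (\<lambda>s. indicator {0..h} s * (t - s) powr (\<alpha> t - 1))"
      proof (rule Bochner_Integration.integrable_bound)
        show "integrable M (\<lambda>s. (2 * X) * indicator {0..h} s)" using hi by simp
        show "(\<lambda>s. indicator {0..h} s * (t - s) powr (\<alpha> t - 1)) \<in> borel_measurable M"
          using hM(2) by measurable
        show "AE s in M. norm (indicator {0..h} s * (t - s) powr (\<alpha> t - 1))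
            \<le> norm ((2 * X) * indicator {0..h} s)"
          using b(2) by (intro AE_I2) (auto simp: indicator_def X_def)
      qed
      have "(1/2) powr A * X * h = (LINT s|M. (1/2) powr A * X * indicator {0..h} s)"
        using hM spM h by (simp add: Int_absorb2)
      also have "\<dots> \<le> (LINT s|M. indicator {0..h} s * (t - s) powr (\<alpha> t - 1))"
      proof (rule integral_mono[OF _ int])
        show "integrable M (\<lambda>s. (1/2) powr A * X * indicator {0..h} s)" using hi by simp
        show "(1/2) powr A * X * indicator {0..h} s \<le> indicator {0..h} s * (t - s) powr (\<alpha> t - 1)" for s
          using b(1)[of s] by (simp add: indicator_def)
      qed
      finally have *: "(1/2) powr A * X * h \<le> (LINT s|M. indicator {0..h} s * (t - s) powr (\<alpha> t - 1))" .
      have rG: "m * \<alpha> t \<le> rGamma (\<alpha> t)" "0 \<le> m * \<alpha> t" using m a by auto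
      have "d * (\<alpha> t * X) = (m * \<alpha> t / h) * ((1/2) powr A * X * h)"
        using h by (simp add: d_def)
      also have "\<dots> \<le> (rGamma (\<alpha> t) / h) * (LINT s|M. indicator {0..h} s * (t - s) powr (\<alpha> t - 1))"
        using * rG h by (intro mult_mono divide_right_mono) (auto simp: X_def)
      also have "\<dots> = riemann_liouville \<alpha> f t"
        using riemann_liouville_kernel[OF t(1), of \<alpha> f] by (simp add: M_def[symmetric] k)
      finally show ?thesis by (simp add: X_def)
    qed
    have Ri: "integrable M (riemann_liouville \<alpha> f)"
      using L1[OF fL] by (simp add: L1_def M_def)
    have "ennreal d * (\<integral>\<^sup>+t. g t * indicator (I n) t \<partial>M) = (\<integral>\<^sup>+t. ennreal d * (g t * indicator (I n) t) \<partial>M)"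
      by (rule nn_integral_cmult[symmetric]) (simp add: I_def)
    also have "\<dots> \<le> (\<integral>\<^sup>+t. ennreal \<bar>riemann_liouville \<alpha> f t\<bar> \<partial>M)"
    proof (rule nn_integral_mono)
      fix t assume "t \<in> space M"
      then have t: "t \<in> {0..1}" by (simp add: spM)
      show "ennreal d * (g t * indicator (I n) t) \<le> ennreal \<bar>riemann_liouville \<alpha> f t\<bar>"
      proof (cases "t \<in> I n")
        case True
        then have "2 * h \<le> t" by (simp add: I_def h_def)
        from low[OF t this] show ?thesis
          using True d nonneg[OF t] by (auto simp: g_def ennreal_mult[symmetric] intro!: ennreal_leI)
      qed simp
    qed
    also have "\<dots> = ennreal (L1_norm (riemann_liouville \<alpha> f))"
      using Ri unfolding L1_norm_def M_def by (intro nn_integral_eq_integral) auto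
    also have "\<dots> \<le> ennreal C" using C[OF fL] fn by (intro ennreal_leI) simp
    finally have *: "ennreal d * (\<integral>\<^sup>+t. g t * indicator (I n) t \<partial>M) \<le> ennreal C" .
    have "(\<integral>\<^sup>+t. g t * indicator (I n) t \<partial>M)
        = ennreal (1 / d) * (ennreal d * (\<integral>\<^sup>+t. g t * indicator (I n) t \<partial>M))"
      using d by (simp add: mult.assoc[symmetric] ennreal_mult[symmetric])
    also have "\<dots> \<le> ennreal (1 / d) * ennreal C" using * by (rule mult_left_mono) simp
    also have "\<dots> = ennreal (C / d)" using d by (simp add: ennreal_mult'[symmetric])
    finally show ?thesis .
  qed
  \<comment> \<open>At \<open>t = 0\<close>, which lies in no \<open>I n\<close>, \<open>g\<close> is \<open>0\<close> since \<open>0 powr x = 0\<close>.\<close>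
  have "g t = (SUP n. g t * indicator (I n) t)" if "t \<in> space M" for t
  proof (cases "t = 0")
    case False
    with that have "t > 0" by (simp add: spM)
    then obtain n where "inverse (real (Suc n)) < t / 2"
      using reals_Archimedean[of "t / 2"] by auto
    then have n: "t \<in> I n" by (simp add: I_def field_simps)
    show ?thesis
    proof (rule antisym)
      show "g t \<le> (SUP n. g t * indicator (I n) t)"
        using n by (intro SUP_upper2[of n]) auto
      show "(SUP n. g t * indicator (I n) t) \<le> g t"
        by (intro SUP_least) (auto simp: indicator_def)
    qed
  qed (simp add: g_def)
  then have "(\<integral>\<^sup>+t. g t \<partial>M) = (\<integral>\<^sup>+t. (SUP n. g t * indicator (I n) t) \<partial>M)"
    by (rule nn_integral_cong)
  also have "\<dots> = (SUP n. \<integral>\<^sup>+t. g t * indicator (I n) t \<partial>M)"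
  proof (rule nn_integral_monotone_convergence_SUP)
    have "I n \<subseteq> I k" if "n \<le> k" for n k
      using that by (auto simp: I_def intro: order_trans[rotated] frac_le)
    then show "incseq (\<lambda>n t. g t * indicator (I n) t)"
      by (auto simp: incseq_def le_fun_def indicator_def)
  qed (simp add: I_def)
  also have "\<dots> \<le> ennreal (C / d)" by (intro SUP_least part)
  also have "\<dots> < \<infinity>" by simp
  finally show ?thesis by (simp add: g_def)
qed

theorem proposition3p5:
  fixes \<alpha> :: "real \<Rightarrow> real"
  assumes "\<alpha> \<in> borel_measurable (lebesgue_on {0..1})"
    and "\<And>t. t \<in> {0..1} \<Longrightarrow> \<alpha> t \<ge> 0"
    and "AE t in lebesgue_on {0..1}. \<alpha> t > 0"
    and "bounded (\<alpha> ` {0..1})"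
    and "\<exists>c1 c2. c1 > 0 \<and> c2 > 0 \<and>
           (\<forall>s\<in>{0..1}. \<forall>t. s \<le> t \<and> t \<le> min (2 * s) 1 \<longrightarrow>
              c1 * \<alpha> s \<le> \<alpha> t \<and> \<alpha> t \<le> c2 * \<alpha> s)"
  shows "bounded_operator_L1 (riemann_liouville \<alpha>) \<longleftrightarrow>
    (\<integral>\<^sup>+ t. ennreal (\<alpha> t * t powr (\<alpha> t - 1)) \<partial>lebesgue_on {0..1}) < \<infinity>"
proof -
  obtain A where "\<And>x. x \<in> \<alpha> ` {0..1} \<Longrightarrow> norm x \<le> A"
    using assms(4) unfolding bounded_iff by blast
  then have A: "\<alpha> t \<le> A" if "t \<in> {0..1}" for t
    using that by fastforce
  obtain c1 c2 where c: "c1 > 0" "c2 > 0"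
    and reg: "\<And>s t. s \<in> {0..1} \<Longrightarrow> s \<le> t \<Longrightarrow> t \<le> min (2 * s) 1 \<Longrightarrow>
       c1 * \<alpha> s \<le> \<alpha> t \<and> \<alpha> t \<le> c2 * \<alpha> s"
    using assms(5) by blast
  show ?thesis
    using bounded_riemann_liouville_imp_finite[OF assms(1,2) A]
      riemann_liouville_bounded[OF assms(1,2) A c reg]
    by blast
qed

end
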